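(* Let $L$ and $B$ be commuting matrix ordinary differential operators in $\mathcal{R}_\ell[D]$, with $L=A_0+A_1D$ of order one and invertible leading coefficient $A_1$. Let $f(\lambda,\mu)=\mathrm{DRes}(L-\lambda,B-\mu)\in C[\lambda,\mu]$. Then the following inclusion of ideals in $C[\lambda,\mu]$ holds: $$\mathtt{BC}(L,B)\subseteq(f_{red}),$$ where $f_{red}=h_1\cdots h_s$, with $h_1,\dots,h_s$ the distinct irreducible factors of $f$. Moreover, if $f(L,B)=\mathbf{0}$ then $$(f)\subseteq\mathtt{BC}(L,B)\subseteq(f_{red}).$$
   Context: $K$ is a differential field with derivation $\partial$ (write $a'=\partial(a)$) whose field of constants $C$ is algebraically closed of characteristic zero. $\mathcal{R}_\ell=M_\ell(K)$, with entrywise derivation $D(A)=A'$. $\mathcal{R}_\ell[D]$ is the ring of matrix ordinary differential operators $\sum_j B_jD^j$, $B_j\in\mathcal{R}_\ell$, with commutation rule $DA=AD+A'$; $\mathbf{0}$ is its zero. $\lambda,\mu$ are algebraic variables over $K$ with $\partial\lambda=\partial\mu=0$. For $L=A_0+A_1D$ with $A_1$ invertible and $B=\sum_{j=0}^nB_jD^j$, $n\ge1$, put $N_\lambda=-A_1^{-1}(A_0-\lambda I_\ell)$, $p_0(N_\lambda)=I_\ell$, $p_j(N_\lambda)=p_{j-1}(N_\lambda)N_\lambda+(p_{j-1}(N_\lambda))'$ for $j\ge1$, $M(L-\lambda,B-\mu)=B_0-\mu I_\ell+\sum_{j=1}^nB_jp_j(N_\lambda)$, and $\mathrm{DRes}(L-\lambda,B-\mu)=\det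 M(L-\lambda,B-\mu)$. When $L$ and $B$ commute this is a polynomial in $C[\lambda,\mu]$. For commuting $L,B$ and $g=\sum a_{i,j}\lambda^i\mu^j\in C[\lambda,\mu]$, $g(L,B)=\sum a_{i,j}L^iB^j\in\mathcal{R}_\ell[D]$. The Burchnall-Chaundy ideal is $\mathtt{BC}(L,B)=\{g\in C[\lambda,\mu]\mid g(L,B)=\mathbf{0}\}$. *)

theory Defs
  imports "HOL-Analysis.Analysis" "HOL-Computational_Algebra.Computational_Algebra"
    "HOL-Computational_Algebra.Field_as_Ring"
begin

section \<open>Differential rings and fields\<close>

class differential_ring = comm_ring_1 +
  fixes der :: "'a \<Rightarrow> 'a"
  assumes der_add: "der (x + y) = der x + der y"
    and der_mult: "der (x * y) = der x * y + x * der y"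
begin

lemma der_0 [simp]: "der 0 = 0"
  using der_add[of 0 0] by simp

lemma der_1 [simp]: "der 1 = 0"
  using der_mult[of 1 1] by simp

lemma der_minus: "der (- x) = - der x"
  using der_add[of x "- x"] by (simp add: eq_neg_iff_add_eq_0 add.commute)

lemma der_diff: "der (x - y) = der x - der y"
  using der_add[of x "- y"] by (simp add: der_minus)

lemma der_sum: "der (sum f A) = (\<Sum>x\<in>A. der (f x))"
  by (induction A rule: infinite_finite_induct) (simp_all add: der_add)

end

class differential_field = field_char_0 + differential_ring

lemma der_inverse:
  fixes x :: "'a::differential_field"
  assumes "der x = 0"
  shows "der (inverse x) = 0"
proof (cases "x = 0")
  case False
  have "0 = der (x * inverse x)"
    using False by simp
  also have "\<dots> = x * der (inverse x)"
    by (simp only: der_mult assms mult_zero_left add_0_left)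
  finally show ?thesis
    using False by simp
qed simp

text \<open>The indeterminate of a polynomial ring is a constant; the derivation acts on the
  coefficients only.\<close>

instantiation poly :: (differential_ring) differential_ring
begin

definition der_poly :: "'a poly \<Rightarrow> 'a poly"
  where "der_poly p = map_poly der p"

instance
proof
  fix p q :: "'a poly"
  show "der (p + q) = der p + der q"
    by (simp add: poly_eq_iff der_poly_def coeff_map_poly der_add)
  show "der (p * q) = der p * q + p * der q"
    by (simp add: poly_eq_iff der_poly_def coeff_map_poly coeff_mult der_sum der_mult sum.distrib)
qed

end

section \<open>The field of constants\<close>

typedef (overloaded) 'k constants = "{c :: 'k::differential_field. der c = 0}"
  by (rule exI[of _ 0]) simp

setup_lifting type_definition_constants

instantiation constants :: (differential_field) field
begin

lift_definition zero_constants :: "'a constants" is 0 by simp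
lift_definition one_constants :: "'a constants" is 1 by simp
lift_definition plus_constants :: "'a constants \<Rightarrow> 'a constants \<Rightarrow> 'a constants" is "(+)"
  by (simp add: der_add)
lift_definition minus_constants :: "'a constants \<Rightarrow> 'a constants \<Rightarrow> 'a constants" is "(-)"
  by (simp add: der_diff)
lift_definition uminus_constants :: "'a constants \<Rightarrow> 'a constants" is uminus
  by (simp add: der_minus)
lift_definition times_constants :: "'a constants \<Rightarrow> 'a constants \<Rightarrow> 'a constants" is "(*)"
  by (simp add: der_mult)
lift_definition inverse_constants :: "'a constants \<Rightarrow> 'a constants" is inverse
  by (simp add: der_inverse)
lift_definition divide_constants :: "'a constants \<Rightarrow> 'a constants \<Rightarrow> 'a constants" is "(/)"
  by (simp add: divide_inverse der_mult der_inverse)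

instance
proof
  fix a b c :: "'a constants"
  show "a * b * c = a * (b * c)" by transfer (simp add: mult.assoc)
  show "a * b = b * a" by transfer (simp add: mult.commute)
  show "1 * a = a" by transfer simp
  show "a + b + c = a + (b + c)" by transfer (simp add: add.assoc)
  show "a + b = b + a" by transfer (simp add: add.commute)
  show "0 + a = a" by transfer simp
  show "- a + a = 0" by transfer simp
  show "a - b = a + - b" by transfer simp
  show "(a + b) * c = a * c + b * c" by transfer (simp add: distrib_right)
  show "(0 :: 'a constants) \<noteq> 1" by transfer simp
  show "a \<noteq> 0 \<Longrightarrow> inverse a * a = 1" by transfer simp
  show "a div b = a * inverse b" by transfer (simp add: divide_inverse)
  show "inverse (0 :: 'a constants) = 0" by transfer simp
qed

end

lemma Rep_constants_of_nat:
  "Rep_constants (of_nat n :: 'a::differential_field constants) = of_nat n"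
  by (induction n) (simp_all add: zero_constants.rep_eq one_constants.rep_eq plus_constants.rep_eq)

instance constants :: (differential_field) field_char_0
proof
  show "inj (of_nat :: nat \<Rightarrow> 'a constants)"
    by (metis Rep_constants_of_nat injI of_nat_eq_iff)
qed

text \<open>The following instances do not depend on any choice beyond the trivial normalisation of a
  field (every nonzero element is a unit, normalised to 1). They turn \<^typ>\<open>'k constants poly poly\<close>
  into a factorial ring with a normalised representative for every class of associates.\<close>

instantiation constants :: (differential_field)
  "{unique_euclidean_ring, normalization_euclidean_semiring, normalization_semidom_multiplicative}"
begin

definition [simp]: "normalize_constants = (normalize_field :: 'a constants \<Rightarrow> _)"
definition [simp]: "unit_factor_constants = (unit_factor_field :: 'a constants \<Rightarrow> _)"
definition [simp]: "modulo_constants = (mod_field :: 'a constants \<Rightarrow> _)"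
definition [simp]: "euclidean_size_constants = (euclidean_size_field :: 'a constants \<Rightarrow> _)"
definition [simp]: "division_segment (x :: 'a constants) = 1"

instance
  by standard (simp_all add: dvd_field_iff field_split_simps split: if_splits)

end

instantiation constants :: (differential_field) euclidean_ring_gcd
begin

definition gcd_constants :: "'a constants \<Rightarrow> 'a constants \<Rightarrow> 'a constants"
  where "gcd_constants = Euclidean_Algorithm.gcd"
definition lcm_constants :: "'a constants \<Rightarrow> 'a constants \<Rightarrow> 'a constants"
  where "lcm_constants = Euclidean_Algorithm.lcm"
definition Gcd_constants :: "'a constants set \<Rightarrow> 'a constants"
  where "Gcd_constants = Euclidean_Algorithm.Gcd"
definition Lcm_constants :: "'a constants set \<Rightarrow> 'a constants"
  where "Lcm_constants = Euclidean_Algorithm.Lcm"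

instance
  by standard
    (simp_all add: gcd_constants_def lcm_constants_def Gcd_constants_def Lcm_constants_def)

end

instance constants :: (differential_field) field_gcd ..

section \<open>Matrix ordinary differential operators\<close>

definition mat_der :: "'a::differential_ring^'l^'l \<Rightarrow> 'a^'l^'l"
  where "mat_der A = (\<chi> i j. der (A $ i $ j))"

lemma mat_der_0 [simp]: "mat_der 0 = 0"
  by (simp add: mat_der_def vec_eq_iff)

lemma mat_der_add: "mat_der (A + B) = mat_der A + mat_der B"
  by (simp add: mat_der_def vec_eq_iff der_add)

lemma mat_der_mult: "mat_der (A ** B) = mat_der A ** B + A ** mat_der B"
  by (simp add: mat_der_def vec_eq_iff matrix_matrix_mult_def der_sum der_mult sum.distrib)

lemma mat_der_mat_1 [simp]: "mat_der (mat 1) = 0"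
  by (simp add: mat_der_def vec_eq_iff mat_def)

lemma matrix_mult_0_left [simp]: "(0 :: 'a::semiring_1^'n^'m) ** (B :: 'a^'p^'n) = 0"
  by (simp add: matrix_matrix_mult_def vec_eq_iff)

lemma matrix_mult_0_right [simp]: "(A :: 'a::semiring_1^'n^'m) ** (0 :: 'a^'p^'n) = 0"
  by (simp add: matrix_matrix_mult_def vec_eq_iff)

lemma matrix_add_mult_distrib_right:
  "((A :: 'a::semiring_1^'n^'m) + B) ** (C :: 'a^'p^'n) = A ** C + B ** C"
  by (simp add: matrix_matrix_mult_def vec_eq_iff distrib_right sum.distrib)

lemma mat_1_neq_0 [simp]: "(mat 1 :: 'a::zero_neq_one^'n^'n) \<noteq> 0"
  by (simp add: mat_def vec_eq_iff)

text \<open>The operator with coefficients \<open>B\<^sub>j\<close> is represented by the \<^type>\<open>poly\<close> with the same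
  coefficient sequence. Only its additive structure is used: the multiplication of \<^type>\<open>poly\<close>
  (commuting indeterminate) and the multiplication of \<^type>\<open>vec\<close> (componentwise) are both wrong
  here, so products are defined from matrix multiplication and the rule
  \<open>D \<cdot> B\<^sub>j D\<^sup>j = B\<^sub>j' D\<^sup>j + B\<^sub>j D\<^sup>j\<^sup>+\<^sup>1\<close>.\<close>

definition lmult_mat :: "'a::differential_ring^'l^'l \<Rightarrow> ('a^'l^'l) poly \<Rightarrow> ('a^'l^'l) poly"
  where "lmult_mat A Q = map_poly (\<lambda>X. A ** X) Q"

definition lmult_D :: "('a::differential_ring^'l^'l) poly \<Rightarrow> ('a^'l^'l) poly"
  where "lmult_D Q = map_poly mat_der Q + pCons 0 Q"

definition ore_mult ::
  "('a::differential_ring^'l^'l) poly \<Rightarrow> ('a^'l^'l) poly \<Rightarrow> ('a^'l^'l) poly"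
  where "ore_mult P Q = (\<Sum>i\<le>degree P. lmult_mat (coeff P i) ((lmult_D ^^ i) Q))"

lemma coeff_lmult_mat: "coeff (lmult_mat A Q) i = A ** coeff Q i"
  by (simp add: lmult_mat_def coeff_map_poly)

lemma lmult_mat_0 [simp]: "lmult_mat 0 Q = 0"
  by (simp add: poly_eq_iff coeff_lmult_mat)

lemma lmult_mat_1 [simp]: "lmult_mat (mat 1) Q = Q"
  by (simp add: poly_eq_iff coeff_lmult_mat)

lemma lmult_mat_zero_right [simp]: "lmult_mat A 0 = 0"
  by (simp add: poly_eq_iff coeff_lmult_mat)

lemma lmult_mat_add_left: "lmult_mat (A + B) Q = lmult_mat A Q + lmult_mat B Q"
  by (simp add: poly_eq_iff coeff_lmult_mat matrix_add_mult_distrib_right)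

lemma lmult_mat_add: "lmult_mat A (P + Q) = lmult_mat A P + lmult_mat A Q"
  by (simp add: poly_eq_iff coeff_lmult_mat matrix_add_ldistrib)

lemma lmult_mat_mult: "lmult_mat (A ** B) Q = lmult_mat A (lmult_mat B Q)"
  by (simp add: poly_eq_iff coeff_lmult_mat matrix_mul_assoc)

lemma lmult_mat_sum: "lmult_mat A (sum f S) = (\<Sum>x\<in>S. lmult_mat A (f x))"
  by (induction S rule: infinite_finite_induct) (simp_all add: lmult_mat_add)

lemma lmult_D_0 [simp]: "lmult_D 0 = 0"
  by (simp add: lmult_D_def)

lemma lmult_D_add: "lmult_D (P + Q) = lmult_D P + lmult_D Q"
proof -
  have "map_poly mat_der (P + Q) = map_poly mat_der P + map_poly mat_der Q"
    by (simp add: poly_eq_iff coeff_map_poly mat_der_add)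
  moreover have "pCons 0 (P + Q) = pCons 0 P + pCons 0 Q"
    by simp
  ultimately show ?thesis
    by (simp only: lmult_D_def ac_simps)
qed

lemma lmult_D_sum: "lmult_D (sum f S) = (\<Sum>x\<in>S. lmult_D (f x))"
  by (induction S rule: infinite_finite_induct) (simp_all add: lmult_D_add)

lemma lmult_D_lmult_mat: "lmult_D (lmult_mat A Q) = lmult_mat (mat_der A) Q + lmult_mat A (lmult_D Q)"
  by (rule poly_eqI)
    (simp add: lmult_D_def coeff_lmult_mat coeff_map_poly mat_der_mult coeff_pCons
      matrix_add_ldistrib ac_simps split: nat.splits)

lemma lmult_D_power_add: "(lmult_D ^^ i) (P + Q) = (lmult_D ^^ i) P + (lmult_D ^^ i) Q"
  by (induction i) (simp_all add: lmult_D_add)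

lemma lmult_D_power_0 [simp]: "(lmult_D ^^ i) 0 = 0"
  by (induction i) simp_all

lemma ore_mult_bound:
  assumes "degree P \<le> n"
  shows "ore_mult P Q = (\<Sum>i\<le>n. lmult_mat (coeff P i) ((lmult_D ^^ i) Q))"
  unfolding ore_mult_def
  by (rule sum.mono_neutral_left) (use assms in \<open>auto simp: coeff_eq_0\<close>)

lemma ore_mult_add_left: "ore_mult (P + Q) R = ore_mult P R + ore_mult Q R"
proof -
  define n where "n = max (degree P) (degree Q)"
  have "degree (P + Q) \<le> n" "degree P \<le> n" "degree Q \<le> n"
    by (auto simp: n_def degree_add_le)
  then show ?thesis
    by (simp add: ore_mult_bound[of _ n] lmult_mat_add_left sum.distrib)
qed

lemma ore_mult_add_right: "ore_mult P (Q + R) = ore_mult P Q + ore_mult P R"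
  by (simp add: ore_mult_def lmult_D_power_add lmult_mat_add sum.distrib)

lemma ore_mult_0_left [simp]: "ore_mult 0 R = 0"
  by (simp add: ore_mult_def)

lemma ore_mult_0_right [simp]: "ore_mult P 0 = 0"
  by (simp add: ore_mult_def)

lemma ore_mult_sum_left: "ore_mult (sum f S) R = (\<Sum>x\<in>S. ore_mult (f x) R)"
  by (induction S rule: infinite_finite_induct) (simp_all add: ore_mult_add_left)

lemma ore_mult_lmult_mat: "ore_mult (lmult_mat A P) R = lmult_mat A (ore_mult P R)"
proof -
  have "degree (lmult_mat A P) \<le> degree P"
    by (rule degree_le) (simp add: coeff_lmult_mat coeff_eq_0)
  then show ?thesis
    by (simp add: ore_mult_bound[of _ "degree P"] coeff_lmult_mat lmult_mat_mult lmult_mat_sum)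
qed

lemma ore_mult_lmult_D: "ore_mult (lmult_D P) R = lmult_D (ore_mult P R)"
proof -
  let ?n = "degree P"
  have d: "degree (map_poly mat_der P) \<le> ?n"
    by (rule degree_le) (simp add: coeff_map_poly coeff_eq_0)
  have "degree (pCons 0 P) \<le> Suc ?n"
    by (rule degree_pCons_le)
  then have "ore_mult (pCons 0 P) R =
      (\<Sum>i\<le>Suc ?n. lmult_mat (coeff (pCons 0 P) i) ((lmult_D ^^ i) R))"
    by (rule ore_mult_bound)
  also have "\<dots> = (\<Sum>i\<le>?n. lmult_mat (coeff P i) ((lmult_D ^^ Suc i) R))"
    by (subst sum.atMost_Suc_shift) simp
  finally have 1: "ore_mult (pCons 0 P) R =
      (\<Sum>i\<le>?n. lmult_mat (coeff P i) (lmult_D ((lmult_D ^^ i) R)))"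
    by simp
  have 2: "ore_mult (map_poly mat_der P) R =
      (\<Sum>i\<le>?n. lmult_mat (mat_der (coeff P i)) ((lmult_D ^^ i) R))"
    using d by (simp add: ore_mult_bound[of _ ?n] coeff_map_poly)
  have 3: "lmult_D (ore_mult P R) =
      (\<Sum>i\<le>?n. lmult_mat (mat_der (coeff P i)) ((lmult_D ^^ i) R)) +
      (\<Sum>i\<le>?n. lmult_mat (coeff P i) (lmult_D ((lmult_D ^^ i) R)))"
    by (simp add: ore_mult_def lmult_D_sum lmult_D_lmult_mat sum.distrib)
  show ?thesis
    by (simp add: lmult_D_def[of P] ore_mult_add_left 1 2 3)
qed

lemma ore_mult_lmult_D_power: "ore_mult ((lmult_D ^^ i) P) R = (lmult_D ^^ i) (ore_mult P R)"
  by (induction i) (simp_all add: ore_mult_lmult_D)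

lemma ore_mult_assoc: "ore_mult (ore_mult P Q) R = ore_mult P (ore_mult Q R)"
  by (simp add: ore_mult_def[of P] ore_mult_sum_left ore_mult_lmult_mat ore_mult_lmult_D_power)

lemma ore_mult_const [simp]: "ore_mult [:A:] Q = lmult_mat A Q"
  by (simp add: ore_mult_def)

lemma lmult_D_monom_1: "(lmult_D ^^ i) [:mat 1:] = monom (mat 1) i"
proof (induction i)
  case (Suc i)
  have "map_poly mat_der (monom (mat 1) i :: ('a::differential_ring^'l^'l) poly) = 0"
    by (simp add: poly_eq_iff coeff_map_poly coeff_monom)
  then show ?case
    using Suc by (simp add: lmult_D_def monom_Suc)
qed (simp add: monom_0)

lemma ore_mult_1_right [simp]: "ore_mult P [:mat 1:] = P"
proof -
  have "lmult_mat A (monom (mat 1) i) = monom A i" for A :: "'a^'b^'b" and i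
    by (simp add: poly_eq_iff coeff_lmult_mat coeff_monom)
  then show ?thesis
    by (simp add: ore_mult_def lmult_D_monom_1 poly_as_sum_of_monoms)
qed

typedef (overloaded) ('k, 'l) matrix_odo = "UNIV :: ('k::differential_field^'l::finite^'l) poly set"
  by simp

setup_lifting type_definition_matrix_odo

instantiation matrix_odo :: (differential_field, finite) ring_1
begin

lift_definition zero_matrix_odo :: "('a, 'b) matrix_odo" is 0 .
lift_definition one_matrix_odo :: "('a, 'b) matrix_odo" is "[:mat 1:]" .
lift_definition plus_matrix_odo ::
  "('a, 'b) matrix_odo \<Rightarrow> ('a, 'b) matrix_odo \<Rightarrow> ('a, 'b) matrix_odo" is "(+)" .
lift_definition minus_matrix_odo ::
  "('a, 'b) matrix_odo \<Rightarrow> ('a, 'b) matrix_odo \<Rightarrow> ('a, 'b) matrix_odo" is "(-)" .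
lift_definition uminus_matrix_odo ::
  "('a, 'b) matrix_odo \<Rightarrow> ('a, 'b) matrix_odo" is uminus .
lift_definition times_matrix_odo ::
  "('a, 'b) matrix_odo \<Rightarrow> ('a, 'b) matrix_odo \<Rightarrow> ('a, 'b) matrix_odo" is ore_mult .

instance
proof
  fix P Q R :: "('a, 'b) matrix_odo"
  show "P * Q * R = P * (Q * R)" by transfer (rule ore_mult_assoc)
  show "1 * P = P" by transfer simp
  show "P * 1 = P" by transfer simp
  show "P + Q + R = P + (Q + R)" by transfer (simp add: add.assoc)
  show "P + Q = Q + P" by transfer (simp add: add.commute)
  show "0 + P = P" by transfer simp
  show "- P + P = 0" by transfer simp
  show "P - Q = P + - Q" by transfer simp
  show "(P + Q) * R = P * R + Q * R" by transfer (rule ore_mult_add_left)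
  show "P * (Q + R) = P * Q + P * R" by transfer (rule ore_mult_add_right)
  show "(0 :: ('a, 'b) matrix_odo) \<noteq> 1"
    by transfer simp
qed

end

lift_definition odo_coeff :: "('k::differential_field, 'l::finite) matrix_odo \<Rightarrow> nat \<Rightarrow> 'k^'l^'l"
  is coeff .

lift_definition odo_order :: "('k::differential_field, 'l::finite) matrix_odo \<Rightarrow> nat"
  is degree .

lift_definition mat_odo :: "'k::differential_field^'l^'l \<Rightarrow> ('k, 'l::finite) matrix_odo"
  is "\<lambda>A. [:A:]" .

lift_definition D_odo :: "('k::differential_field, 'l::finite) matrix_odo"
  is "[:0, mat 1:]" .

text \<open>Checks of the representation: the commutation rule, compatibility with the operations of
  the matrix ring, and \<open>B = \<Sum>\<^sub>j B\<^sub>j D\<^sup>j\<close>.\<close>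

lemma D_odo_mult_mat_odo: "D_odo * mat_odo A = mat_odo A * D_odo + mat_odo (mat_der A)"
  by transfer
    (simp add: ore_mult_def lmult_D_def lmult_mat_def map_poly_pCons)

lemma mat_odo_add: "mat_odo (A + B) = mat_odo A + mat_odo B"
  by transfer simp

lemma mat_odo_mult: "mat_odo (A ** B) = mat_odo A * mat_odo B"
  by transfer (simp add: lmult_mat_def map_poly_pCons)

lemma mat_odo_1: "mat_odo (mat 1) = 1"
  by transfer simp

lemma D_odo_mult: "D_odo * Q = Abs_matrix_odo (lmult_D (Rep_matrix_odo Q))"
  by (simp add: times_matrix_odo_def D_odo.rep_eq ore_mult_def)

lemma Rep_D_odo_power: "Rep_matrix_odo (D_odo ^ i) = monom (mat 1) i"
proof (induction i)
  case 0
  then show ?case by (simp add: one_matrix_odo.rep_eq monom_0)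
next
  case (Suc i)
  have "Rep_matrix_odo (D_odo ^ Suc i :: ('a, 'b) matrix_odo) = lmult_D (monom (mat 1) i)"
    using Suc by (simp add: D_odo_mult Abs_matrix_odo_inverse)
  also have "\<dots> = monom (mat 1) (Suc i)"
    by (metis funpow.simps(2) comp_apply lmult_D_monom_1)
  finally show ?case .
qed

lemma Rep_matrix_odo_sum: "Rep_matrix_odo (sum f S) = (\<Sum>x\<in>S. Rep_matrix_odo (f x))"
  by (induction S rule: infinite_finite_induct)
    (simp_all add: zero_matrix_odo.rep_eq plus_matrix_odo.rep_eq)

lemma matrix_odo_expansion: "B = (\<Sum>j\<le>odo_order B. mat_odo (odo_coeff B j) * D_odo ^ j)"
proof -
  have "lmult_mat A (monom (mat 1) i) = monom A i" for A :: "'a^'b^'b" and i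
    by (simp add: poly_eq_iff coeff_lmult_mat coeff_monom)
  then have "Rep_matrix_odo B =
      Rep_matrix_odo (\<Sum>j\<le>odo_order B. mat_odo (odo_coeff B j) * D_odo ^ j)"
    by (simp add: Rep_matrix_odo_sum times_matrix_odo.rep_eq mat_odo.rep_eq Rep_D_odo_power
        odo_coeff.rep_eq odo_order.rep_eq poly_as_sum_of_monoms)
  then show ?thesis
    by (simp add: Rep_matrix_odo_inject)
qed

section \<open>The differential resultant\<close>

text \<open>Bivariate polynomials are of type \<open>_ poly poly\<close> with inner indeterminate \<open>\<lambda>\<close> and outer
  indeterminate \<open>\<mu>\<close>: the coefficient \<open>a\<^bsub>i,j\<^esub>\<close> of \<open>\<lambda>\<^sup>i \<mu>\<^sup>j\<close> in \<open>g\<close> is \<open>coeff (coeff g j) i\<close>.\<close>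

definition var_lam :: "'k::comm_ring_1 poly poly"
  where "var_lam = [:[:0, 1:]:]"

definition var_mu :: "'k::comm_ring_1 poly poly"
  where "var_mu = [:0, 1:]"

definition lift_mat :: "'k::comm_ring_1^'l^'l \<Rightarrow> ('k poly poly)^'l^'l"
  where "lift_mat A = (\<chi> i j. [:[:A $ i $ j:]:])"

definition N_mat :: "('k::differential_field, 'l::finite) matrix_odo \<Rightarrow> ('k poly poly)^'l^'l"
  where "N_mat L =
    - (lift_mat (matrix_inv (odo_coeff L 1)) ** (lift_mat (odo_coeff L 0) - mat var_lam))"

primrec p_mat :: "('a::differential_ring)^'l^'l \<Rightarrow> nat \<Rightarrow> 'a^'l^'l" where
  "p_mat N 0 = mat 1"
| "p_mat N (Suc j) = p_mat N j ** N + mat_der (p_mat N j)"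

definition M_mat ::
  "('k::differential_field, 'l::finite) matrix_odo \<Rightarrow> ('k, 'l) matrix_odo \<Rightarrow> ('k poly poly)^'l^'l"
  where "M_mat L B = lift_mat (odo_coeff B 0) - mat var_mu
    + (\<Sum>j = 1..odo_order B. lift_mat (odo_coeff B j) ** p_mat (N_mat L) j)"

text \<open>\<open>DRes L B\<close> is \<open>DRes(L - \<lambda>, B - \<mu>)\<close>.\<close>

definition DRes ::
  "('k::differential_field, 'l::finite) matrix_odo \<Rightarrow> ('k, 'l) matrix_odo \<Rightarrow> 'k poly poly"
  where "DRes L B = det (M_mat L B)"

section \<open>The Burchnall-Chaundy ideal\<close>

definition embed_poly2 :: "'k::differential_field constants poly poly \<Rightarrow> 'k poly poly"
  where "embed_poly2 = map_poly (map_poly Rep_constants)"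

definition const_odo :: "'k::differential_field constants \<Rightarrow> ('k, 'l::finite) matrix_odo"
  where "const_odo a = mat_odo (mat (Rep_constants a))"

definition eval_odo ::
  "'k::differential_field constants poly poly \<Rightarrow> ('k, 'l::finite) matrix_odo \<Rightarrow>
    ('k, 'l) matrix_odo \<Rightarrow> ('k, 'l) matrix_odo"
  where "eval_odo g L B =
    (\<Sum>j\<le>degree g. \<Sum>i\<le>degree (coeff g j). const_odo (coeff (coeff g j) i) * L ^ i * B ^ j)"

definition BC ::
  "('k::differential_field, 'l::finite) matrix_odo \<Rightarrow> ('k, 'l) matrix_odo \<Rightarrow>
    'k constants poly poly set"
  where "BC L B = {g. eval_odo g L B = 0}"

definition principal_ideal :: "'r::comm_ring_1 \<Rightarrow> 'r set"
  where "principal_ideal f = range (\<lambda>q. q * f)"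

text \<open>The distinct irreducible factors of \<open>f\<close> are taken up to associates, each class being
  represented by its normalised element; another choice changes \<open>f\<^sub>r\<^sub>e\<^sub>d\<close> by a unit only.
  For \<open>f \<noteq> 0\<close> the product is finite.\<close>

definition irreducible_factors :: "'r::factorial_semiring \<Rightarrow> 'r set"
  where "irreducible_factors f = {h. irreducible h \<and> normalize h = h \<and> h dvd f}"

definition f_red :: "'r::factorial_semiring \<Rightarrow> 'r"
  where "f_red f = \<Prod>(irreducible_factors f)"

end

theory Submission
  imports Defs
begin

text \<open>An operator \<open>P\<close> acts on the solutions of \<open>L Y = \<lambda> Y\<close>, that is \<open>Y' = N Y\<close>, as
  multiplication by a matrix over \<open>K[\<lambda>]\<close>. For \<open>P = L\<close> this matrix is \<open>\<lambda> I\<close>; for \<open>P = B\<close> it is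
  \<open>M + \<mu> I\<close>. Since \<open>B\<close> commutes with \<open>L\<close> it preserves the solutions, which means \<open>M' = N M - M N\<close>;
  hence \<open>f = det M\<close> is a constant. For \<open>g\<close> in the Burchnall-Chaundy ideal the matrix of
  \<open>g(L, B) = 0\<close> is \<open>g I\<close> modulo left multiples of \<open>M\<close>, so \<open>g I = - Q M\<close> and \<open>f\<close> divides \<open>g\<^sup>\<ell>\<close>
  over \<open>K\<close>. The leading coefficient of \<open>f\<close> in \<open>\<mu>\<close> is a sign, so the divisibility holds over the
  constants, and every irreducible factor of \<open>f\<close> divides \<open>g\<close>.\<close>

no_notation fps_nth (infixl "$" 75)

section \<open>Square matrices\<close>

lemma mat_mult_left: "mat c ** X = (\<chi> i j. c * X $ i $ j)"
  for X :: "'a::semiring_1^'n^'m"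
  by (simp add: matrix_matrix_mult_def mat_def vec_eq_iff if_distrib[of "\<lambda>x. x * _"] cong: if_cong)

lemma mat_mult_right: "X ** mat c = (\<chi> i j. X $ i $ j * c)"
  for X :: "'a::semiring_1^'n^'m"
  by (simp add: matrix_matrix_mult_def mat_def vec_eq_iff if_distrib[of "\<lambda>x. _ * x"] cong: if_cong)

lemma mat_mult_commute: "mat c ** X = X ** mat c"
  for X :: "'a::comm_semiring_1^'n^'n"
  by (simp add: mat_mult_left mat_mult_right mult.commute)

lemma matrix_mult_diff_left: "(A - B) ** C = A ** C - B ** C"
  for A :: "'a::ring_1^'n^'m"
  by (simp add: matrix_matrix_mult_def vec_eq_iff left_diff_distrib sum_subtractf)

lemma matrix_mult_diff_right: "A ** (B - C) = A ** B - A ** C"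
  for A :: "'a::ring_1^'n^'m"
  by (simp add: matrix_matrix_mult_def vec_eq_iff right_diff_distrib sum_subtractf)

lemma matrix_mult_minus_left: "(- A) ** C = - (A ** C)"
  for A :: "'a::ring_1^'n^'m"
  by (simp add: matrix_matrix_mult_def vec_eq_iff sum_negf)

lemma matrix_mult_minus_right: "A ** (- C) = - (A ** C)"
  for A :: "'a::ring_1^'n^'m"
  by (simp add: matrix_matrix_mult_def vec_eq_iff sum_negf)

lemma matrix_mult_sum_left: "(\<Sum>x\<in>S. f x) ** C = (\<Sum>x\<in>S. f x ** C)"
  for C :: "'a::semiring_1^'n^'m"
  by (induction S rule: infinite_finite_induct) (simp_all add: matrix_add_mult_distrib_right)

lemma matrix_mult_sum_right: "C ** (\<Sum>x\<in>S. f x) = (\<Sum>x\<in>S. C ** f x)"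
  for C :: "'a::semiring_1^'n^'m"
  by (induction S rule: infinite_finite_induct) (simp_all add: matrix_add_ldistrib)

lemma matrix_inv_left: "matrix_inv A ** A = mat 1" and matrix_inv_right: "A ** matrix_inv A = mat 1"
  if "invertible A" for A :: "'a::semiring_1^'n^'m"
proof -
  have "A ** matrix_inv A = mat 1 \<and> matrix_inv A ** A = mat 1"
    using that unfolding invertible_def matrix_inv_def by (rule someI_ex)
  then show "matrix_inv A ** A = mat 1" "A ** matrix_inv A = mat 1"
    by auto
qed

lemma det_mat: "det (mat c :: 'a::comm_ring_1^'n^'n) = c ^ CARD('n)"
  by (simp add: det_diagonal mat_def)

lemma mat_der_sum: "mat_der (sum f S) = (\<Sum>x\<in>S. mat_der (f x))"
  by (induction S rule: infinite_finite_induct) (simp_all add: mat_der_add)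

lemma mat_der_mat: "mat_der (mat c) = mat (der c)"
  by (simp add: mat_der_def mat_def vec_eq_iff)

lemma mat_der_diff: "mat_der (A - B) = mat_der A - mat_der B"
  by (simp add: mat_der_def vec_eq_iff der_diff)

section \<open>Jacobi's formula for an isomonodromic equation\<close>

text \<open>Polynomials in one indeterminate modulo its square serve as dual numbers: a derivation
  \<open>d\<close> amounts to the ring homomorphism \<open>a \<mapsto> a + d(a)\<epsilon>\<close>.\<close>

definition dual_cong :: "'a::comm_ring_1 poly \<Rightarrow> 'a poly \<Rightarrow> bool"
  where "dual_cong p q \<longleftrightarrow> coeff p 0 = coeff q 0 \<and> coeff p 1 = coeff q 1"

lemma dual_cong_add: "dual_cong a b \<Longrightarrow> dual_cong c d \<Longrightarrow> dual_cong (a + c) (b + d)"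
  by (simp add: dual_cong_def)

lemma dual_cong_mult: "dual_cong a b \<Longrightarrow> dual_cong c d \<Longrightarrow> dual_cong (a * c) (b * d)"
  by (simp add: dual_cong_def coeff_mult)

lemma dual_cong_refl: "dual_cong a a"
  by (simp add: dual_cong_def)

lemma dual_cong_sum: "(\<And>x. x \<in> S \<Longrightarrow> dual_cong (f x) (g x)) \<Longrightarrow> dual_cong (sum f S) (sum g S)"
  by (induction S rule: infinite_finite_induct) (simp_all add: dual_cong_add dual_cong_refl)

lemma dual_cong_prod: "(\<And>x. x \<in> S \<Longrightarrow> dual_cong (f x) (g x)) \<Longrightarrow> dual_cong (prod f S) (prod g S)"
  by (induction S rule: infinite_finite_induct) (simp_all add: dual_cong_mult dual_cong_refl)

lemma dual_cong_det:
  assumes "\<And>i j. dual_cong (A $ i $ j) (B $ i $ j)"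
  shows "dual_cong (det A) (det B)"
  unfolding det_def by (intro dual_cong_sum dual_cong_mult dual_cong_prod dual_cong_refl assms)

definition dual_mat :: "'a::comm_ring_1^'n^'n \<Rightarrow> 'a^'n^'n \<Rightarrow> 'a poly^'n^'n"
  where "dual_mat A B = (\<chi> i j. [:A $ i $ j, B $ i $ j:])"

text \<open>With e the indeterminate, (A + B e)(C + D e) = A C + (A D + B C) e modulo e^2, and
  determinants are multiplicative.\<close>

lemma dual_cong_det_mult:
  "dual_cong (det (dual_mat A B) * det (dual_mat C D)) (det (dual_mat (A ** C) (A ** D + B ** C)))"
  unfolding det_mul[symmetric]
  by (rule dual_cong_det)
    (simp add: dual_cong_def dual_mat_def matrix_matrix_mult_def coeff_sum coeff_mult sum.distrib ac_simps)

text \<open>The map a -> a + d(a) e is a ring homomorphism modulo e^2, and the determinant is an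
  integer polynomial in the entries, so the two commute. An arbitrary \<open>d\<close> covers the
  zero derivation as well as \<open>der\<close>.\<close>

lemma dual_cong_det_dual_mat:
  fixes d :: "'a::comm_ring_1 \<Rightarrow> 'a" and A :: "'a^'n^'n"
  assumes add: "\<And>x y. d (x + y) = d x + d y"
    and mult: "\<And>x y. d (x * y) = d x * y + x * d y"
  shows "dual_cong (det (dual_mat A (\<chi> i j. d (A $ i $ j)))) [:det A, d (det A):]"
proof -
  have [simp]: "d 0 = 0" "d 1 = 0"
    using add[of 0 0] mult[of 1 1] by simp_all
  have "d (- x) = - d x" for x
    using add[of x "- x"] by (simp add: eq_neg_iff_add_eq_0 add.commute)
  then have [simp]: "d (of_int (sign p)) = 0" for p :: "'n \<Rightarrow> 'n"
    by (simp add: sign_def)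
  have prod: "dual_cong (\<Prod>x\<in>S. [:f x, d (f x):]) [:\<Prod>x\<in>S. f x, d (\<Prod>x\<in>S. f x):]"
    for S and f :: "'n \<Rightarrow> 'a"
    by (induction S rule: infinite_finite_induct)
      (simp_all add: dual_cong_def coeff_mult mult one_pCons)
  have sum: "dual_cong (\<Sum>x\<in>S. [:f x, d (f x):]) [:\<Sum>x\<in>S. f x, d (\<Sum>x\<in>S. f x):]"
    for S and f :: "('n \<Rightarrow> 'n) \<Rightarrow> 'a"
    by (induction S rule: infinite_finite_induct) (simp_all add: dual_cong_def add)
  have "dual_cong (of_int (sign p) * (\<Prod>i\<in>UNIV. dual_mat A (\<chi> i j. d (A $ i $ j)) $ i $ p i))
      [:of_int (sign p) * (\<Prod>i\<in>UNIV. A $ i $ p i), d (of_int (sign p) * (\<Prod>i\<in>UNIV. A $ i $ p i)):]"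
    for p :: "'n \<Rightarrow> 'n"
    using prod[of "\<lambda>i. A $ i $ p i" UNIV]
    by (simp add: dual_mat_def dual_cong_def coeff_mult mult of_int_poly)
  then show ?thesis
    unfolding det_def
    using sum[of "\<lambda>p. of_int (sign p) * (\<Prod>i\<in>UNIV. A $ i $ p i)" "{p. p permutes UNIV}"]
    by (smt (verit) dual_cong_def dual_cong_sum)
qed

text \<open>Modulo e^2 the hypothesis reads (M + M' e)(1 + N e) = (1 + N e) M. Taking determinants
  and cancelling det (1 + N e), whose constant term is 1, leaves det M + (det M)' e = det M.\<close>

lemma der_det_eq_0:
  fixes M N :: "'a::differential_ring^'n^'n"
  assumes "mat_der M + M ** N = N ** M"
  shows "der (det M) = 0"
proof -
  let ?a = "det (dual_mat (mat 1) N)"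
  have M': "dual_cong (det (dual_mat M (mat_der M))) [:det M, der (det M):]"
    using dual_cong_det_dual_mat[of der M] by (simp add: mat_der_def der_add der_mult)
  have M0: "dual_cong (det (dual_mat M 0)) [:det M, 0:]"
    using dual_cong_det_dual_mat[of "\<lambda>_. 0" M] by (simp add: zero_vec_def)
  have a: "coeff ?a 0 = 1"
  proof -
    have "coeff ?a 0 = det (mat 1 :: 'a^'n^'n)"
      by (simp add: det_def poly_sum poly_prod dual_mat_def mat_def flip: poly_0_coeff_0)
    then show ?thesis by simp
  qed
  have "dual_cong (det (dual_mat M (mat_der M)) * ?a) (det (dual_mat M (mat_der M + M ** N)))"
    using dual_cong_det_mult[of M "mat_der M" "mat 1" N] by (simp add: add.commute)
  moreover have "dual_cong (?a * det (dual_mat M 0)) (det (dual_mat M (N ** M)))"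
    using dual_cong_det_mult[of "mat 1" N M 0] by simp
  ultimately have "coeff (det (dual_mat M (mat_der M)) * ?a) 1 = coeff (?a * det (dual_mat M 0)) 1"
    using assms by (simp add: dual_cong_def)
  then show ?thesis
    using M' M0 a by (simp add: dual_cong_def coeff_mult mult.commute)
qed

section \<open>Action of operators on the solutions of a first-order system\<close>

lemma lift_mat_0 [simp]: "lift_mat 0 = 0"
  by (simp add: lift_mat_def vec_eq_iff)

lemma lift_mat_1 [simp]: "lift_mat (mat 1) = mat 1"
  by (simp add: lift_mat_def vec_eq_iff mat_def one_pCons)

lemma lift_mat_add: "lift_mat (A + B) = lift_mat A + lift_mat B"
  by (simp add: lift_mat_def vec_eq_iff)

lemma lift_mat_mult: "lift_mat (A ** B) = lift_mat A ** lift_mat B"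
proof -
  have "(\<Sum>x\<in>S. [:[:f x:]:]) = [:[:sum f S:]:]" for f :: "'b \<Rightarrow> 'a" and S
    by (induction S rule: infinite_finite_induct) simp_all
  then show ?thesis
    by (simp add: lift_mat_def vec_eq_iff matrix_matrix_mult_def)
qed

lemma der_const_poly: "der [:c:] = [:der c:]"
  by (simp add: der_poly_def map_poly_pCons)

lemma mat_der_lift_mat: "mat_der (lift_mat A) = lift_mat (mat_der A)"
  by (simp add: mat_der_def lift_mat_def vec_eq_iff der_const_poly)

lemma der_var_lam: "der var_lam = 0"
  by (simp add: var_lam_def der_const_poly) (simp add: der_poly_def map_poly_pCons map_poly_1)

lemma der_var_mu: "der var_mu = 0"
  by (simp add: var_mu_def der_poly_def map_poly_pCons map_poly_1)

text \<open>If \<open>Y' = N Y\<close>, then \<open>P Y = (odo_symbol N P) Y\<close>.\<close>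

definition odo_symbol ::
  "('k poly poly)^'l^'l \<Rightarrow> ('k::differential_field, 'l::finite) matrix_odo \<Rightarrow> ('k poly poly)^'l^'l"
  where "odo_symbol N P = (\<Sum>j\<le>odo_order P. lift_mat (odo_coeff P j) ** p_mat N j)"

lemma odo_symbol_bound:
  assumes "odo_order P \<le> n"
  shows "odo_symbol N P = (\<Sum>j\<le>n. lift_mat (odo_coeff P j) ** p_mat N j)"
  unfolding odo_symbol_def
  by (rule sum.mono_neutral_left)
    (use assms in \<open>auto simp: odo_coeff.rep_eq odo_order.rep_eq coeff_eq_0\<close>)

lemma odo_symbol_0 [simp]: "odo_symbol N 0 = 0"
  by (simp add: odo_symbol_def odo_coeff.rep_eq zero_matrix_odo.rep_eq)

lemma odo_symbol_add: "odo_symbol N (P + Q) = odo_symbol N P + odo_symbol N Q"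
proof -
  define n where "n = max (odo_order P) (odo_order Q)"
  have "odo_order (P + Q) \<le> n" "odo_order P \<le> n" "odo_order Q \<le> n"
    by (auto simp: n_def odo_order.rep_eq plus_matrix_odo.rep_eq degree_add_le)
  then show ?thesis
    by (simp add: odo_symbol_bound[of _ n] odo_coeff.rep_eq plus_matrix_odo.rep_eq lift_mat_add
        matrix_add_mult_distrib_right sum.distrib)
qed

lemma odo_symbol_sum: "odo_symbol N (sum f S) = (\<Sum>x\<in>S. odo_symbol N (f x))"
  by (induction S rule: infinite_finite_induct) (simp_all add: odo_symbol_add)

lemma Rep_mat_odo_mult: "Rep_matrix_odo (mat_odo A * P) = lmult_mat A (Rep_matrix_odo P)"
  by (simp add: times_matrix_odo.rep_eq mat_odo.rep_eq)

lemma odo_symbol_mat_odo_mult: "odo_symbol N (mat_odo A * P) = lift_mat A ** odo_symbol N P"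
proof -
  have "odo_order (mat_odo A * P) \<le> odo_order P"
    by (simp add: odo_order.rep_eq Rep_mat_odo_mult, rule degree_le)
      (simp add: coeff_lmult_mat coeff_eq_0)
  then show ?thesis
    by (simp add: odo_symbol_bound[of _ "odo_order P"] odo_coeff.rep_eq Rep_mat_odo_mult
        coeff_lmult_mat lift_mat_mult matrix_mult_sum_right matrix_mul_assoc)
qed

lemma odo_symbol_D_power: "odo_symbol N (D_odo ^ j) = p_mat N j"
proof -
  have "degree (monom (mat 1 :: 'a^'b^'b) j) = j"
    by (simp add: degree_monom_eq)
  then have "odo_symbol N (D_odo ^ j) =
      (\<Sum>i\<le>j. if i = j then p_mat N j else 0)"
    unfolding odo_symbol_def
    by (intro sum.cong) (auto simp: odo_order.rep_eq odo_coeff.rep_eq Rep_D_odo_power coeff_monom)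
  then show ?thesis by simp
qed

lemma odo_symbol_mat_odo: "odo_symbol N (mat_odo A) = lift_mat A"
  using odo_symbol_mat_odo_mult[of N A 1] odo_symbol_D_power[of N 0] by simp

text \<open>If Y' = N Y and T is the symbol of P, then D (P Y) = (T Y)' = (T' + T N) Y.\<close>

lemma odo_symbol_D_mult:
  "odo_symbol N (D_odo * P) = mat_der (odo_symbol N P) + odo_symbol N P ** N"
proof -
  \<comment> \<open>By additivity it suffices to treat A D^j, where moving D past A produces the
    Leibniz terms and the recursion of \<open>p_mat\<close>.\<close>
  have *: "odo_symbol N (D_odo * (mat_odo A * D_odo ^ j)) =
      mat_der (lift_mat A ** p_mat N j) + lift_mat A ** p_mat N j ** N" for A :: "'a^'b^'b" and j
  proof -
    have "D_odo * (mat_odo A * D_odo ^ j) = mat_odo A * D_odo ^ Suc j + mat_odo (mat_der A) * D_odo ^ j"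
      by (simp add: mult.assoc[symmetric] D_odo_mult_mat_odo distrib_right)
    then show ?thesis
      by (simp add: odo_symbol_add odo_symbol_mat_odo_mult odo_symbol_D_power mat_der_mult
          mat_der_lift_mat matrix_add_ldistrib matrix_mul_assoc ac_simps del: power_Suc)
  qed
  show ?thesis
    by (subst (1 2 3) matrix_odo_expansion[of P])
      (simp add: sum_distrib_left odo_symbol_sum * odo_symbol_mat_odo_mult odo_symbol_D_power
        mat_der_sum matrix_mult_sum_left sum.distrib)
qed

text \<open>The hypothesis says that \<open>Q\<close> maps solutions of \<open>Y' = N Y\<close> to solutions.\<close>

lemma odo_symbol_mult:
  assumes "mat_der (odo_symbol N Q) + odo_symbol N Q ** N = N ** odo_symbol N Q"
  shows "odo_symbol N (P * Q) = odo_symbol N P ** odo_symbol N Q"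
proof -
  let ?T = "odo_symbol N Q"
  have D: "odo_symbol N (D_odo ^ i * Q) = p_mat N i ** ?T" for i
  proof (induction i)
    case (Suc i)
    \<comment> \<open>The symbol is (p_i T)' + p_i T N. The hypothesis turns T' + T N into N T, so
      that p_i N + p_i', the next \<open>p_mat\<close>, appears in front of T.\<close>
    have "odo_symbol N (D_odo ^ Suc i * Q) =
        mat_der (p_mat N i) ** ?T + p_mat N i ** (mat_der ?T + ?T ** N)"
      by (simp add: mult.assoc odo_symbol_D_mult Suc mat_der_mult matrix_mul_assoc
          matrix_add_ldistrib add.assoc)
    then show ?case
      by (simp add: assms matrix_mul_assoc matrix_add_mult_distrib_right add.commute)
  qed simp
  show ?thesis
    by (subst (1 2) matrix_odo_expansion[of P])
      (simp add: sum_distrib_right mult.assoc odo_symbol_sum odo_symbol_mat_odo_mult D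
        odo_symbol_D_power matrix_mult_sum_left matrix_mul_assoc)
qed

text \<open>The separate B_0 term of \<open>M_mat\<close> is the j = 0 term of the symbol, since p_0
  is the identity.\<close>

lemma M_mat_eq: "M_mat L B = odo_symbol (N_mat L) B - mat var_mu"
  unfolding M_mat_def odo_symbol_def
  by (subst sum.atMost_shift) (simp add: sum.atLeast1_atMost_eq)

section \<open>Degree of the resultant in the second variable\<close>

text \<open>Degree \<open>card S\<close> is reached only by taking the linear coefficient of every
  factor. The index is fixed because that coefficient may vanish.\<close>

lemma coeff_prod_degree_le_1:
  assumes "\<And>i. i \<in> S \<Longrightarrow> degree (f i) \<le> 1" "finite S"
  shows "degree (prod f S) \<le> card S \<and> coeff (prod f S) (card S) = (\<Prod>i\<in>S. coeff (f i) 1)"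
  using assms(2,1)
proof (induction S)
  case (insert x S)
  then have IH: "degree (prod f S) \<le> card S" "coeff (prod f S) (card S) = (\<Prod>i\<in>S. coeff (f i) 1)"
    and x: "degree (f x) \<le> 1"
    by auto
  have "coeff (f x * prod f S) (1 + card S) = coeff (f x) 1 * coeff (prod f S) (card S)"
  proof -
    \<comment> \<open>For i = 0 the complementary index exceeds the degree bound of the product; for
      larger i the coefficient of \<open>f x\<close> is 0.\<close>
    have "coeff (f x) i * coeff (prod f S) (1 + card S - i) = 0" if "i \<noteq> 1" for i
      using that IH x by (cases i) (auto simp: coeff_eq_0)
    then show ?thesis
      unfolding coeff_mult by (subst sum.remove[of _ 1]) auto
  qed
  then show ?case
    using insert.hyps IH degree_mult_le[of "f x" "prod f S"] x by simp
qed simp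

lemma det_degree_le_1:
  fixes X :: "'a::comm_ring_1 poly^'n^'n"
  assumes "\<And>i j. degree (X $ i $ j) \<le> 1"
  shows "degree (det X) \<le> CARD('n)" "coeff (det X) CARD('n) = det (\<chi> i j. coeff (X $ i $ j) 1)"
proof -
  have *: "degree (\<Prod>i\<in>UNIV. X $ i $ p i) \<le> CARD('n)"
    "coeff (\<Prod>i\<in>UNIV. X $ i $ p i) CARD('n) = (\<Prod>i\<in>UNIV. coeff (X $ i $ p i) 1)" for p :: "'n \<Rightarrow> 'n"
    using coeff_prod_degree_le_1[of UNIV "\<lambda>i. X $ i $ p i"] assms by auto
  show "degree (det X) \<le> CARD('n)"
    unfolding det_def using * by (auto intro!: degree_sum_le simp: of_int_poly intro: degree_smult_le[THEN order_trans])
  show "coeff (det X) CARD('n) = det (\<chi> i j. coeff (X $ i $ j) 1)"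
    unfolding det_def using * by (simp add: coeff_sum of_int_poly)
qed

text \<open>The outer indeterminate is mu, so such a matrix has its entries in K[lambda].\<close>

definition mu_free :: "('a::comm_ring_1 poly poly)^'n^'m \<Rightarrow> bool"
  where "mu_free X \<longleftrightarrow> (\<forall>i j. degree (X $ i $ j) = 0)"

lemma mu_free_add: "mu_free X \<Longrightarrow> mu_free Y \<Longrightarrow> mu_free (X + Y)"
  using degree_add_le by (fastforce simp: mu_free_def)

lemma mu_free_uminus: "mu_free X \<Longrightarrow> mu_free (- X)"
  by (simp add: mu_free_def)

lemma mu_free_sum: "(\<And>x. x \<in> S \<Longrightarrow> mu_free (f x)) \<Longrightarrow> mu_free (sum f S)"
  by (induction S rule: infinite_finite_induct) (simp_all add: mu_free_add, simp_all add: mu_free_def)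

lemma mu_free_mult:
  assumes "mu_free X" "mu_free Y" shows "mu_free (X ** Y)"
proof -
  have "degree (X $ i $ k * Y $ k $ j) \<le> 0" for i j k
    using degree_mult_le[of "X $ i $ k" "Y $ k $ j"] assms by (simp add: mu_free_def)
  then have "degree (\<Sum>k\<in>UNIV. X $ i $ k * Y $ k $ j) \<le> 0" for i j
    by (intro degree_sum_le) auto
  then show ?thesis
    by (simp add: mu_free_def matrix_matrix_mult_def)
qed

lemma mu_free_mat_der: "mu_free X \<Longrightarrow> mu_free (mat_der X)"
  by (simp add: mu_free_def mat_der_def der_poly_def) (metis map_poly_degree_leq le_zero_eq)

lemma mu_free_lift_mat: "mu_free (lift_mat A)"
  by (simp add: mu_free_def lift_mat_def)

lemma mu_free_mat: "degree c = 0 \<Longrightarrow> mu_free (mat c)"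
  by (simp add: mu_free_def mat_def)

lemma mu_free_p_mat: "mu_free N \<Longrightarrow> mu_free (p_mat N j)"
  by (induction j) (simp_all add: mu_free_add mu_free_mult mu_free_mat_der mu_free_mat)

lemma mu_free_N_mat: "mu_free (N_mat L)"
proof -
  have "mu_free (lift_mat (odo_coeff L 0) + - mat var_lam)"
    by (intro mu_free_add mu_free_uminus mu_free_lift_mat mu_free_mat) (simp add: var_lam_def)
  then show ?thesis
    unfolding N_mat_def by (simp add: mu_free_uminus mu_free_mult mu_free_lift_mat)
qed

text \<open>M is T - mu I with T free of mu, so its matrix of mu-coefficients is -I, and the top
  term of the determinant is that of det (-mu I).\<close>

lemma DRes_leading:
  fixes L B :: "('k::differential_field, 'l::finite) matrix_odo"
  shows "degree (DRes L B) = CARD('l)" "lead_coeff (DRes L B) = (- 1) ^ CARD('l)"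
proof -
  have "mu_free (odo_symbol (N_mat L) B)"
    unfolding odo_symbol_def
    by (intro mu_free_sum mu_free_mult mu_free_lift_mat mu_free_p_mat mu_free_N_mat)
  then have T: "degree (odo_symbol (N_mat L) B $ i $ j) = 0" for i j
    by (simp add: mu_free_def)
  have "degree (M_mat L B $ i $ j) \<le> 1" for i j
    unfolding M_mat_eq by (auto simp: mat_def var_mu_def T intro!: degree_diff_le)
  note d = det_degree_le_1[of "M_mat L B", OF this, folded DRes_def]
  have "(\<chi> i j. coeff (M_mat L B $ i $ j) 1) = mat (- 1)"
    unfolding M_mat_eq by (simp add: vec_eq_iff mat_def var_mu_def T coeff_eq_0)
  with d have c: "coeff (DRes L B) CARD('l) = (- 1) ^ CARD('l)"
    by (simp add: det_mat)
  then have "coeff (DRes L B) CARD('l) \<noteq> 0"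
    by simp
  with d show "degree (DRes L B) = CARD('l)"
    by (meson le_antisym le_degree)
  with c show "lead_coeff (DRes L B) = (- 1) ^ CARD('l)"
    by simp
qed

section \<open>Commuting operators\<close>

lemma odo_coeff_order_1:
  "odo_coeff (mat_odo A\<^sub>0 + mat_odo A\<^sub>1 * D_odo) 0 = A\<^sub>0"
  "odo_coeff (mat_odo A\<^sub>0 + mat_odo A\<^sub>1 * D_odo) 1 = A\<^sub>1"
  by (simp_all add: odo_coeff.rep_eq plus_matrix_odo.rep_eq Rep_mat_odo_mult mat_odo.rep_eq
      D_odo.rep_eq coeff_lmult_mat)

context
  fixes A\<^sub>0 A\<^sub>1 :: "'k::differential_field^'l::finite^'l"
    and L :: "('k, 'l) matrix_odo"
  assumes L: "L = mat_odo A\<^sub>0 + mat_odo A\<^sub>1 * D_odo"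
    and A\<^sub>1: "invertible A\<^sub>1"
begin

text \<open>This is the defining purpose of N: it makes Y' = N Y equivalent to L Y = lambda
  Y.\<close>

lemma lift_A1_N_mat: "lift_mat A\<^sub>1 ** N_mat L = mat var_lam - lift_mat A\<^sub>0"
proof -
  have "lift_mat A\<^sub>1 ** (lift_mat (matrix_inv A\<^sub>1) ** X) = X" for X :: "('k poly poly)^'l^'l"
    by (simp add: matrix_mul_assoc matrix_inv_right[OF A\<^sub>1] flip: lift_mat_mult)
  then show ?thesis
    by (simp add: N_mat_def L odo_coeff_order_1[unfolded One_nat_def] matrix_mult_minus_right)
qed

lemma odo_symbol_L: "odo_symbol (N_mat L) L = mat var_lam"
proof -
  have "odo_symbol (N_mat L) D_odo = N_mat L"
    using odo_symbol_D_power[of "N_mat L" 1] by simp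
  then have "odo_symbol (N_mat L) (mat_odo A\<^sub>0 + mat_odo A\<^sub>1 * D_odo) = mat var_lam"
    by (simp add: odo_symbol_add odo_symbol_mat_odo odo_symbol_mat_odo_mult lift_A1_N_mat)
  then show ?thesis by (simp flip: L)
qed

text \<open>\<open>L\<close> acts as the scalar lambda, which is constant and central, so it
  satisfies the hypothesis of \<open>odo_symbol_mult\<close>.\<close>

lemma odo_symbol_mult_L: "odo_symbol (N_mat L) (P * L) = mat var_lam ** odo_symbol (N_mat L) P"
proof -
  have "odo_symbol (N_mat L) (P * L) = odo_symbol (N_mat L) P ** odo_symbol (N_mat L) L"
    by (rule odo_symbol_mult)
      (simp add: odo_symbol_L mat_der_mat der_var_lam mat_mult_commute)
  then show ?thesis
    by (simp add: odo_symbol_L mat_mult_commute)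
qed

context
  fixes B :: "('k, 'l) matrix_odo"
  assumes commute: "L * B = B * L"
begin

text \<open>With T the symbol of B, that of L B is A_0 T + A_1 (T' + T N) and that of B L is lambda
  T. Since A_1 N = lambda - A_0, equality says A_1 (T' + T N) = A_1 N T, and A_1 cancels.\<close>

lemma odo_symbol_B_intertwines:
  "mat_der (odo_symbol (N_mat L) B) + odo_symbol (N_mat L) B ** N_mat L =
    N_mat L ** odo_symbol (N_mat L) B"
proof -
  let ?T = "odo_symbol (N_mat L) B" and ?N = "N_mat L"
  have "odo_symbol ?N ((mat_odo A\<^sub>0 + mat_odo A\<^sub>1 * D_odo) * B) = mat var_lam ** ?T"
    unfolding L[symmetric] commute by (rule odo_symbol_mult_L)
  then have "lift_mat A\<^sub>0 ** ?T + lift_mat A\<^sub>1 ** (mat_der ?T + ?T ** ?N) = mat var_lam ** ?T"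
    by (simp add: distrib_right mult.assoc odo_symbol_add odo_symbol_mat_odo_mult odo_symbol_D_mult)
  then have "lift_mat A\<^sub>1 ** (mat_der ?T + ?T ** ?N) = lift_mat A\<^sub>1 ** (?N ** ?T)"
    by (simp add: matrix_mul_assoc lift_A1_N_mat matrix_mult_diff_left algebra_simps)
  then have "lift_mat (matrix_inv A\<^sub>1) ** (lift_mat A\<^sub>1 ** (mat_der ?T + ?T ** ?N)) =
      lift_mat (matrix_inv A\<^sub>1) ** (lift_mat A\<^sub>1 ** (?N ** ?T))"
    by simp
  then show ?thesis
    by (simp add: matrix_mul_assoc matrix_inv_left[OF A\<^sub>1] flip: lift_mat_mult)
qed

lemma odo_symbol_mult_B:
  "odo_symbol (N_mat L) (P * B) = odo_symbol (N_mat L) P ** (M_mat L B + mat var_mu)"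
  by (simp add: odo_symbol_mult odo_symbol_B_intertwines M_mat_eq)

text \<open>Subtracting the constant scalar matrix mu I from T preserves T' + T N = N T, so M
  satisfies the same equation.\<close>

lemma der_DRes: "der (DRes L B) = 0"
  unfolding DRes_def
proof (rule der_det_eq_0)
  show "mat_der (M_mat L B) + M_mat L B ** N_mat L = N_mat L ** M_mat L B"
    using odo_symbol_B_intertwines
    by (simp add: M_mat_eq mat_der_diff mat_der_mat der_var_mu matrix_mult_diff_left
        matrix_mult_diff_right mat_mult_commute algebra_simps)
qed

end

end

section \<open>Evaluation at commuting elements\<close>

text \<open>A coefficient map into a noncommutative ring is a parameter so that the construction can
  be iterated: first constants are mapped and lambda goes to \<open>L\<close>, then the resulting
  map on C[lambda] serves as \<open>c\<close> while mu goes to \<open>B\<close>.\<close>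

definition ring_eval :: "('r::comm_ring_1 \<Rightarrow> 'a::ring_1) \<Rightarrow> 'a \<Rightarrow> 'r poly \<Rightarrow> 'a"
  where "ring_eval c b p = (\<Sum>i\<le>degree p. c (coeff p i) * b ^ i)"

locale ring_eval_hom =
  fixes c :: "'r::comm_ring_1 \<Rightarrow> 'a::ring_1" and b :: 'a
  assumes add: "c (x + y) = c x + c y"
    and mult: "c (x * y) = c x * c y"
    and commute: "b * c x = c x * b"
begin

lemma zero [simp]: "c 0 = 0"
  using add[of 0 0] by simp

lemma eval_bound: "degree p \<le> n \<Longrightarrow> ring_eval c b p = (\<Sum>i\<le>n. c (coeff p i) * b ^ i)"
  unfolding ring_eval_def by (rule sum.mono_neutral_left) (auto simp: coeff_eq_0)

lemma eval_0 [simp]: "ring_eval c b 0 = 0"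
  by (simp add: ring_eval_def)

lemma eval_add: "ring_eval c b (p + q) = ring_eval c b p + ring_eval c b q"
proof -
  define n where "n = max (degree p) (degree q)"
  have "degree (p + q) \<le> n" "degree p \<le> n" "degree q \<le> n"
    by (auto simp: n_def degree_add_le)
  then show ?thesis
    by (simp add: eval_bound[of _ n] add distrib_right sum.distrib)
qed

lemma eval_pCons: "ring_eval c b (pCons x p) = c x + ring_eval c b p * b"
proof -
  have "ring_eval c b (pCons x p) = (\<Sum>i\<le>Suc (degree p). c (coeff (pCons x p) i) * b ^ i)"
    by (rule eval_bound) (rule degree_pCons_le)
  also have "\<dots> = c x + ring_eval c b p * b"
    by (subst sum.atMost_Suc_shift)
      (simp add: ring_eval_def sum_distrib_right mult.assoc power_commutes)
  finally show ?thesis .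
qed

lemma eval_smult: "ring_eval c b (smult x p) = c x * ring_eval c b p"
  by (induction p) (simp_all add: eval_pCons mult distrib_left mult.assoc)

lemma eval_commute:
  assumes "\<And>x. a * c x = c x * a" "a * b = b * a"
  shows "a * ring_eval c b p = ring_eval c b p * a"
proof (induction p)
  case (pCons x p)
  then have "a * (ring_eval c b p * b) = ring_eval c b p * b * a"
    by (metis assms(2) mult.assoc)
  then show ?case
    by (simp add: eval_pCons assms(1) distrib_left distrib_right)
qed simp

lemma eval_mult: "ring_eval c b (p * q) = ring_eval c b p * ring_eval c b q"
proof (induction p)
  case (pCons x p)
  \<comment> \<open>Expanding the left side puts \<open>b\<close> after the value of
    \<open>q\<close>, the right side needs it before; \<open>b\<close> commutes with that
    value.\<close>
  have "ring_eval c b p * ring_eval c b q * b = ring_eval c b p * (b * ring_eval c b q)"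
    by (simp add: eval_commute commute mult.assoc)
  then show ?case
    by (simp add: eval_add eval_pCons eval_smult pCons distrib_right mult.assoc)
qed simp

end

lemma mat_odo_0: "mat_odo 0 = 0"
  by transfer simp

text \<open>D c = c D + c' with c' = 0, and scalar matrices commute with all matrices, so c commutes
  with every A D^j.\<close>

lemma const_odo_commute: "const_odo c * P = P * const_odo c"
proof -
  have D: "const_odo c * D_odo = D_odo * const_odo c"
    using Rep_constants[of c] by (simp add: const_odo_def D_odo_mult_mat_odo mat_der_mat mat_odo_0)
  have A: "const_odo c * mat_odo A = mat_odo A * const_odo c" for A :: "'a^'b^'b"
    by (simp add: const_odo_def mat_mult_commute flip: mat_odo_mult)
  have Dj: "const_odo c * D_odo ^ j = D_odo ^ j * const_odo c" for j
    by (induction j) (simp_all add: mult.assoc, metis D mult.assoc)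
  have "const_odo c * (mat_odo A * D_odo ^ j) = mat_odo A * D_odo ^ j * const_odo c"
    for A :: "'a^'b^'b" and j
    by (metis A Dj mult.assoc)
  then show ?thesis
    by (subst (1 2) matrix_odo_expansion[of P]) (simp add: sum_distrib_left sum_distrib_right)
qed

lemma const_odo_add: "const_odo (a + b) = const_odo a + const_odo b"
proof -
  have "mat (x + y) = mat x + (mat y :: 'a^'b^'b)" for x y
    by (simp add: mat_def vec_eq_iff)
  then show ?thesis
    by (simp add: const_odo_def plus_constants.rep_eq mat_odo_add)
qed

lemma const_odo_mult: "const_odo (a * b) = const_odo a * const_odo b"
proof -
  have "mat (x * y) = mat x ** (mat y :: 'a^'b^'b)" for x y
    by (simp add: mat_mult_left) (simp add: mat_def vec_eq_iff)
  then show ?thesis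
    by (simp add: const_odo_def times_constants.rep_eq mat_odo_mult)
qed

lemma ring_eval_hom_const_odo: "ring_eval_hom const_odo L"
  by unfold_locales (rule const_odo_add const_odo_mult const_odo_commute[symmetric])+

lemma eval_odo_eq: "eval_odo g L B = ring_eval (ring_eval const_odo L) B g"
  by (simp add: eval_odo_def ring_eval_def sum_distrib_right)

text \<open>\<open>B\<close> commutes with \<open>L\<close> and with the constants, hence with every
  polynomial in \<open>L\<close>.\<close>

lemma ring_eval_hom_eval_const_odo:
  assumes "L * B = B * L"
  shows "ring_eval_hom (ring_eval const_odo L) B"
proof -
  interpret ring_eval_hom const_odo L by (rule ring_eval_hom_const_odo)
  show ?thesis
    by unfold_locales
      (rule eval_add eval_mult eval_commute const_odo_commute[symmetric] assms[symmetric])+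
qed

lemma eval_odo_mult:
  assumes "L * B = B * L"
  shows "eval_odo (p * q) L B = eval_odo p L B * eval_odo q L B"
  unfolding eval_odo_eq using ring_eval_hom.eval_mult[OF ring_eval_hom_eval_const_odo[OF assms]] .

section \<open>Extension of scalars from the constants\<close>

lemma Rep_constants_0 [simp]: "Rep_constants 0 = 0"
  by (simp add: zero_constants.rep_eq)

lemma Rep_constants_eq_0_iff [simp]: "Rep_constants c = 0 \<longleftrightarrow> c = 0"
  by (metis Rep_constants_0 Rep_constants_inject)

lemma map_Rep_constants_eq_0_iff [simp]: "map_poly Rep_constants p = 0 \<longleftrightarrow> p = 0"
  by (rule map_poly_eq_0_iff) simp_all

lemma Rep_constants_sum: "Rep_constants (sum f S) = (\<Sum>x\<in>S. Rep_constants (f x))"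
  by (induction S rule: infinite_finite_induct) (simp_all add: plus_constants.rep_eq)

lemma map_Rep_constants_add:
  "map_poly Rep_constants (p + q) = map_poly Rep_constants p + map_poly Rep_constants q"
  by (simp add: poly_eq_iff coeff_map_poly plus_constants.rep_eq)

lemma map_Rep_constants_mult:
  "map_poly Rep_constants (p * q) = map_poly Rep_constants p * map_poly Rep_constants q"
  by (simp add: poly_eq_iff coeff_map_poly coeff_mult Rep_constants_sum times_constants.rep_eq)

lemma map_Rep_constants_sum:
  "map_poly Rep_constants (sum f S) = (\<Sum>x\<in>S. map_poly Rep_constants (f x))"
  by (induction S rule: infinite_finite_induct) (simp_all add: map_Rep_constants_add)

lemma coeff_embed_poly2: "coeff (embed_poly2 p) i = map_poly Rep_constants (coeff p i)"
  by (simp add: embed_poly2_def coeff_map_poly)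

lemma embed_poly2_add: "embed_poly2 (p + q) = embed_poly2 p + embed_poly2 q"
  by (rule poly_eqI) (simp add: coeff_embed_poly2 map_Rep_constants_add)

lemma embed_poly2_mult: "embed_poly2 (p * q) = embed_poly2 p * embed_poly2 q"
  by (rule poly_eqI) (simp add: coeff_embed_poly2 coeff_mult
      map_Rep_constants_sum map_Rep_constants_mult)

lemma embed_poly2_1: "embed_poly2 1 = 1"
  by (simp add: embed_poly2_def one_constants.rep_eq)

lemma embed_poly2_power: "embed_poly2 (p ^ n) = embed_poly2 p ^ n"
  by (induction n) (simp_all add: embed_poly2_1 embed_poly2_mult)

lemma embed_poly2_eq_0_iff: "embed_poly2 p = 0 \<longleftrightarrow> p = 0"
  unfolding embed_poly2_def by (rule map_poly_eq_0_iff) simp_all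

lemma degree_embed_poly2: "degree (embed_poly2 p) = degree p"
  unfolding embed_poly2_def by (cases "p = 0") (simp_all add: map_poly_degree_eq)

lemma map_Rep_constants_surj:
  assumes "der p = 0"
  shows "\<exists>q. map_poly Rep_constants q = p"
proof
  have "der (coeff p i) = 0" for i
    using assms by (metis coeff_0 coeff_map_poly der_0 der_poly_def)
  then show "map_poly Rep_constants (map_poly Abs_constants p) = p"
    by (simp add: poly_eq_iff coeff_map_poly Abs_constants_inverse zero_constants_def[symmetric])
qed

lemma embed_poly2_surj:
  assumes "der p = 0"
  shows "\<exists>q. embed_poly2 q = p"
proof -
  have "der (coeff p i) = 0" for i
    using assms by (metis coeff_0 coeff_map_poly der_0 der_poly_def)
  then have "\<forall>i. \<exists>q. map_poly Rep_constants q = coeff p i"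
    using map_Rep_constants_surj by blast
  then have "\<exists>s. \<forall>i. map_poly Rep_constants (s i) = coeff p i"
    by (rule choice)
  then obtain s where s: "\<And>i. map_poly Rep_constants (s i) = coeff p i"
    by blast
  \<comment> \<open>Preimages are chosen for each coefficient separately; cutting the family off at
    \<open>degree p\<close> gives a polynomial, and nothing is lost.\<close>
  define q where "q = (\<Sum>i\<le>degree p. monom (s i) i)"
  have "coeff q i = (if i \<le> degree p then s i else 0)" for i
    by (simp add: q_def coeff_sum coeff_monom)
  then have "embed_poly2 q = p"
    by (intro poly_eqI) (simp add: coeff_embed_poly2 s coeff_eq_0)
  then show ?thesis ..
qed

text \<open>Pseudo-division over the constants survives the extension of scalars, so the remainder
  must vanish for degree reasons.\<close>

lemma embed_poly2_dvd_imp: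
  assumes "embed_poly2 f dvd embed_poly2 p" "f \<noteq> 0"
  shows "\<exists>n. f dvd smult (lead_coeff f ^ n) p"
proof -
  obtain q r where qr: "pseudo_divmod p f = (q, r)"
    by fastforce
  define n where "n = Suc (degree p) - degree f"
  have eq: "smult (lead_coeff f ^ n) p = f * q + r" and deg: "r = 0 \<or> degree r < degree f"
    unfolding n_def using pseudo_divmod[OF assms(2) qr] by auto
  have "embed_poly2 ([:lead_coeff f ^ n:] * p) = embed_poly2 f * embed_poly2 q + embed_poly2 r"
    by (simp add: eq flip: embed_poly2_mult embed_poly2_add)
  then have "embed_poly2 f dvd embed_poly2 f * embed_poly2 q + embed_poly2 r"
    using assms(1) by (metis dvd_mult embed_poly2_mult)
  then have "embed_poly2 f dvd embed_poly2 r"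
    by (metis dvd_add_right_iff dvd_triv_left)
  then have "degree f \<le> degree r" if "r \<noteq> 0"
    using dvd_imp_degree_le[of "embed_poly2 f" "embed_poly2 r"] that
    by (simp add: embed_poly2_eq_0_iff degree_embed_poly2)
  then have "r = 0"
    using deg by fastforce
  then show ?thesis
    using eq by (metis add.right_neutral dvd_triv_left)
qed

section \<open>Symbols of polynomials in the two operators\<close>

lemma embed_poly2_pCons:
  "embed_poly2 (pCons p g) = [:map_poly Rep_constants p:] + embed_poly2 g * var_mu"
  by (simp add: embed_poly2_def map_poly_pCons var_mu_def)

lemma odo_symbol_eval_const:
  assumes "L = mat_odo A\<^sub>0 + mat_odo A\<^sub>1 * D_odo" "invertible A\<^sub>1"
  shows "odo_symbol (N_mat L) (ring_eval const_odo L p) = mat [:map_poly Rep_constants p:]"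
proof (induction p)
  case 0
  then show ?case
    by (simp add: ring_eval_hom.eval_0[OF ring_eval_hom_const_odo])
next
  case (pCons a p)
  have 1: "odo_symbol (N_mat L) (const_odo a) = mat [:[:Rep_constants a:]:]"
    by (simp add: const_odo_def odo_symbol_mat_odo) (simp add: lift_mat_def mat_def vec_eq_iff)
  have 2: "mat x + mat var_lam ** mat y = (mat (x + var_lam * y) :: ('a poly poly)^'b^'b)" for x y
    by (simp add: mat_mult_left) (simp add: mat_def vec_eq_iff)
  have "odo_symbol (N_mat L) (ring_eval const_odo L (pCons a p)) =
      mat ([:[:Rep_constants a:]:] + var_lam * [:map_poly Rep_constants p:])"
    by (simp only: ring_eval_hom.eval_pCons[OF ring_eval_hom_const_odo] odo_symbol_add
        odo_symbol_mult_L[OF assms] pCons.IH 1 2)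
  then show ?case
    by (simp add: var_lam_def map_poly_pCons)
qed

text \<open>The symbol of \<open>g(L, B)\<close> is \<open>g(\<lambda>, M + \<mu>)\<close>, so this is the remainder theorem for matrices.\<close>

lemma odo_symbol_eval_odo:
  assumes L: "L = mat_odo A\<^sub>0 + mat_odo A\<^sub>1 * D_odo" "invertible A\<^sub>1"
    and commute: "L * B = B * L"
  shows "\<exists>Q. odo_symbol (N_mat L) (eval_odo g L B) = mat (embed_poly2 g) + Q ** M_mat L B"
proof (induction g)
  case 0
  then show ?case
    by (intro exI[of _ 0]) (simp add: eval_odo_eq embed_poly2_def
      ring_eval_hom.eval_0[OF ring_eval_hom_eval_const_odo[OF commute]])
next
  case (pCons p g)
  then obtain Q where
    Q: "odo_symbol (N_mat L) (eval_odo g L B) = mat (embed_poly2 g) + Q ** M_mat L B"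
    by blast
  let ?G = "mat (embed_poly2 g)" and ?M = "M_mat L B"
  have "odo_symbol (N_mat L) (eval_odo (pCons p g) L B) =
      mat [:map_poly Rep_constants p:] + (?G + Q ** ?M) ** (?M + mat var_mu)"
    using Q by (simp only: eval_odo_eq odo_symbol_add odo_symbol_eval_const[OF L]
        ring_eval_hom.eval_pCons[OF ring_eval_hom_eval_const_odo[OF commute]]
        odo_symbol_mult_B[OF L commute])
  \<comment> \<open>Since mu I commutes with M, all left multiples of M can be collected; the new
    witness is G + Q M + Q mu.\<close>
  also have "\<dots> = mat [:map_poly Rep_constants p:] + ?G ** mat var_mu +
      (?G + Q ** ?M + Q ** mat var_mu) ** ?M"
  proof -
    have "Q ** mat var_mu ** ?M = Q ** ?M ** mat var_mu"
      by (simp only: matrix_mul_assoc[symmetric] mat_mult_commute[of var_mu ?M])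
    then show ?thesis
      by (simp only: matrix_add_ldistrib matrix_add_mult_distrib_right ac_simps)
  qed
  also have "mat [:map_poly Rep_constants p:] + ?G ** mat var_mu = mat (embed_poly2 (pCons p g))"
    by (simp add: mat_mult_left embed_poly2_pCons) (simp add: mat_def vec_eq_iff)
  finally show ?case by (rule exI)
qed

section \<open>From the determinant to the irreducible factors\<close>

lemma DRes_dvd_power:
  fixes L B :: "('k::differential_field, 'l::finite) matrix_odo"
  assumes "L = mat_odo A\<^sub>0 + mat_odo A\<^sub>1 * D_odo" "invertible A\<^sub>1" "L * B = B * L"
    and "g \<in> BC L B"
  shows "DRes L B dvd embed_poly2 g ^ CARD('l)"
proof -
  obtain Q where "mat (embed_poly2 g) + Q ** M_mat L B = 0"
    using odo_symbol_eval_odo[OF assms(1-3), of g] assms(4) by (auto simp: BC_def)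
  then have "mat (embed_poly2 g) = (- Q) ** M_mat L B"
    by (simp add: matrix_mult_minus_left eq_neg_iff_add_eq_0)
  then have "det (mat (embed_poly2 g) :: ('k poly poly)^'l^'l) = det (- Q) * DRes L B"
    by (simp add: det_mul DRes_def)
  then show ?thesis
    by (simp add: det_mat)
qed

text \<open>Irreducible elements are prime here, so each factor of \<open>f\<close> divides
  \<open>g\<close>; distinct normalised primes are coprime, so their product divides
  \<open>g\<close> too.\<close>

lemma f_red_dvd:
  fixes f g :: "'r::factorial_ring_gcd"
  assumes "f \<noteq> 0" "f dvd g ^ n"
  shows "f_red f dvd g"
proof -
  have "\<Prod>S dvd g" if "finite S" "S \<subseteq> prime_factors f" for S
    using that
  proof (induction S)
    case (insert h S)
    have h: "prime h" "h dvd f"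
      using insert.prems by (auto simp: in_prime_factors_iff)
    then have "h dvd g"
      using assms(2) by (meson dvd_trans prime_dvd_power)
    moreover have "coprime h (\<Prod>S)"
    proof (rule prod_coprime_right)
      fix x assume "x \<in> S"
      with insert have "prime x" "x \<noteq> h"
        by (auto simp: in_prime_factors_iff)
      then show "coprime h x"
        using h(1) by (metis primes_coprime)
    qed
    ultimately show ?case
      using insert by (simp add: divides_mult)
  qed simp
  \<comment> \<open>For nonzero \<open>f\<close> this set is finite; a product over an infinite set
    would be 1 by default.\<close>
  moreover have "irreducible_factors f = prime_factors f"
    using assms(1)
    by (auto simp: irreducible_factors_def in_prime_factors_iff prime_def prime_elem_iff_irreducible)
  ultimately show ?thesis
    by (simp add: f_red_def)
qed

theorem theorem2:
  fixes A\<^sub>0 A\<^sub>1 :: "'k::differential_field^'l::finite^'l"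
    and L B :: "('k, 'l) matrix_odo"
  assumes constants_alg_closed: "\<And>p :: 'k constants poly. degree p > 0 \<Longrightarrow> \<exists>x. poly p x = 0"
    and L: "L = mat_odo A\<^sub>0 + mat_odo A\<^sub>1 * D_odo"
    and A\<^sub>1: "invertible A\<^sub>1"
    and commute: "L * B = B * L"
  shows "\<exists>f :: 'k constants poly poly.
    embed_poly2 f = DRes L B \<and>
    BC L B \<subseteq> principal_ideal (f_red f) \<and>
    (eval_odo f L B = 0 \<longrightarrow>
      principal_ideal f \<subseteq> BC L B \<and> BC L B \<subseteq> principal_ideal (f_red f))"
proof -
  obtain f where f: "embed_poly2 f = DRes L B"
    using embed_poly2_surj[OF der_DRes[OF L A\<^sub>1 commute]] by blast
  have lead: "map_poly Rep_constants (lead_coeff f) = (- 1) ^ CARD('l)"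
    using DRes_leading[of L B] by (metis coeff_embed_poly2 degree_embed_poly2 f)
  then have f0: "f \<noteq> 0"
    by auto
  \<comment> \<open>The sign squares to 1 over K and the embedding is injective, so the leading
    coefficient of \<open>f\<close> is its own inverse.\<close>
  have "map_poly Rep_constants (lead_coeff f * lead_coeff f) = map_poly Rep_constants 1"
    by (simp only: map_Rep_constants_mult lead)
      (simp add: one_constants.rep_eq flip: power_mult_distrib)
  then have unit: "lead_coeff f * lead_coeff f = 1"
    by (metis (no_types, opaque_lifting) Rep_constants_inject coeff_map_poly Rep_constants_0 poly_eqI)
  have BC: "BC L B \<subseteq> principal_ideal (f_red f)"
  proof
    fix g assume "g \<in> BC L B"
    then have "embed_poly2 f dvd embed_poly2 (g ^ CARD('l))"
      using DRes_dvd_power[OF L A\<^sub>1 commute] by (simp add: f embed_poly2_power)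
    then obtain n where "f dvd smult (lead_coeff f ^ n) (g ^ CARD('l))"
      using embed_poly2_dvd_imp f0 by blast
    \<comment> \<open>A second factor \<open>lead_coeff f ^ n\<close> cancels the one left by
      pseudo-division.\<close>
    then have "f dvd smult (lead_coeff f ^ n) (smult (lead_coeff f ^ n) (g ^ CARD('l)))"
      by (rule dvd_smult)
    then have "f dvd g ^ CARD('l)"
      by (simp add: unit flip: power_mult_distrib)
    then have "f_red f dvd g"
      by (rule f_red_dvd[OF f0])
    then show "g \<in> principal_ideal (f_red f)"
      by (auto simp: principal_ideal_def mult.commute elim!: dvdE)
  qed
  have "principal_ideal f \<subseteq> BC L B" if "eval_odo f L B = 0"
    using that by (auto simp: principal_ideal_def BC_def eval_odo_mult[OF commute])
  with f BC show ?thesis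
    by blast
qed

end
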